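(* Let $d \geq 2$ and let $\Lambda_d$ be the additive group of $d \times d$ integer matrices with trace $0$. For $a \in \Lambda_d$ let $\mathcal{C}(a) = \det(tI-a) \in \mathbb{Z}[t]$, and let $\mathcal{G}(\mathcal{C}(a))$ be the Galois group over $\mathbb{Q}$ of the splitting field of $\mathcal{C}(a)$, regarded as a subgroup of the symmetric group $S_d$. Let $\mathcal{G}_d$ be the set of all $\mathcal{G}(\mathcal{C}(a))$ as $a$ ranges over $\Lambda_d$. Suppose that $E \subset \Lambda_d$ has positive upper Banach density. Then there exists $b \in E$ such that $$\mathcal{G}_d \subset \mathcal{G}(\mathcal{C}(E-b)) := \{ \mathcal{G}(\mathcal{C}(e-b)) : e \in E\}.$$
   Context: $\Lambda_d$ is identified with $\mathbb{Z}^N$, $N = d^2-1$, by a choice of $\mathbb{Z}$-basis. For $E \subset \mathbb{Z}^N$ and $F_n = [-n,n]^N \cap \mathbb{Z}^N$, the upper Banach density is $d^*(E) = \sup\{ \limsup_n |E \cap (F_n + a_n)|/|F_n| : (a_n) \text{ a sequence in } \mathbb{Z}^N\}$; $E$ has positive upper Banach density if $d^*(E)>0$. For a monic $P \in \mathbb{Z}[t]$ of degree $d$, the Galois group of its splitting field is viewed as a subgroup of $S_d$, well defined up to conjugation in $S_d$, through its action on the $d$ roots of $P$ listed with multiplicity (on pairs $(\lambda,i)$ with $\lambda$ a root and $1 \le i \le \mathrm{mult}(\lambda)$, the Galois group acts by $\sigma(\lambda,i) = (\sigma(\lambda),i)$). Thus $\mathcal{G}(P)$ is understood as a conjugacy class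 of subgroups of $S_d$. *)

theory Defs
  imports
    "Jordan_Normal_Form.Char_Poly"
    "Jordan_Normal_Form.VS_Connect"
    "HOL-Algebra.Generated_Fields"
    "HOL-Algebra.QuotRing"
    "HOL-Library.Extended_Real"
    "HOL-Library.Liminf_Limsup"
    "HOL-Combinatorics.Permutations"
    Complex_Main
begin

definition trace_zero_mats :: "nat \<Rightarrow> int mat set" where
  "trace_zero_mats d = {a \<in> carrier_mat d d. (\<Sum>i<d. a $$ (i, i)) = 0}"

definition mat_combination :: "nat \<Rightarrow> nat \<Rightarrow> (nat \<Rightarrow> int mat) \<Rightarrow> int vec \<Rightarrow> int mat" where
  "mat_combination d N B v = mat d d (\<lambda>(i, j). \<Sum>k<N. v $ k * B k $$ (i, j))"

definition trace_zero_basis :: "nat \<Rightarrow> (nat \<Rightarrow> int mat) \<Rightarrow> bool" where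
  "trace_zero_basis d B \<longleftrightarrow>
     (\<forall>k < d\<^sup>2 - 1. B k \<in> trace_zero_mats d) \<and>
     (\<forall>a \<in> trace_zero_mats d.
        \<exists>!v. v \<in> carrier_vec (d\<^sup>2 - 1) \<and> a = mat_combination d (d\<^sup>2 - 1) B v)"

text \<open>The subset of \<open>\<int>\<^sup>N\<close>, \<open>N = d\<^sup>2 - 1\<close>, that corresponds to \<open>E\<close> under the basis \<open>B\<close>.\<close>

definition coordinates :: "nat \<Rightarrow> (nat \<Rightarrow> int mat) \<Rightarrow> int mat set \<Rightarrow> int vec set" where
  "coordinates d B E =
     {v \<in> carrier_vec (d\<^sup>2 - 1). mat_combination d (d\<^sup>2 - 1) B v \<in> E}"

definition box :: "nat \<Rightarrow> nat \<Rightarrow> int vec set" where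
  "box N n = {v \<in> carrier_vec N. \<forall>i<N. \<bar>v $ i\<bar> \<le> int n}"

definition upper_banach_density :: "nat \<Rightarrow> int vec set \<Rightarrow> ereal" where
  "upper_banach_density N E =
     (SUP a \<in> {a :: nat \<Rightarrow> int vec. \<forall>n. a n \<in> carrier_vec N}.
        limsup (\<lambda>n. ereal (real (card (E \<inter> (\<lambda>v. v + a n) ` box N n)) / real (card (box N n)))))"

text \<open>Splitting fields over \<open>\<rat>\<close> are realised inside \<open>\<complex>\<close>; a subfield of \<open>\<complex>\<close> contains \<open>\<rat>\<close>.\<close>

abbreviation complex_poly :: "int poly \<Rightarrow> complex poly" where
  "complex_poly P \<equiv> map_poly of_int P"

definition splitting_field :: "int poly \<Rightarrow> complex ring" where
  "splitting_field P =
     class_ring \<lparr>carrier := generate_field class_ring {z. poly (complex_poly P) z = 0}\<rparr>"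

definition galois_automorphisms :: "int poly \<Rightarrow> (complex \<Rightarrow> complex) set" where
  "galois_automorphisms P =
     {\<sigma> \<in> ring_iso (splitting_field P) (splitting_field P). \<forall>q\<in>\<rat>. \<sigma> q = q}"

definition marked_roots :: "int poly \<Rightarrow> (complex \<times> nat) set" where
  "marked_roots P =
     {(z, i). poly (complex_poly P) z = 0 \<and> 1 \<le> i \<and> i \<le> Polynomial.order z (complex_poly P)}"

definition galois_perms :: "int poly \<Rightarrow> (nat \<Rightarrow> complex \<times> nat) \<Rightarrow> (nat \<Rightarrow> nat) set" where
  "galois_perms P \<phi> =
     {p. p permutes {1..degree P} \<and>
         (\<exists>\<sigma> \<in> galois_automorphisms P.
            \<forall>k \<in> {1..degree P}. \<phi> (p k) = (\<sigma> (fst (\<phi> k)), snd (\<phi> k)))}"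

text \<open>
  Two listings \<open>\<phi>\<close> of the roots differ by precomposition with an element of \<open>S\<^sub>d\<close>, which
  conjugates \<open>galois_perms P \<phi>\<close> by that element. Letting \<open>\<phi>\<close> range over all listings
  therefore gives precisely one conjugacy class of subgroups of \<open>S\<^sub>d\<close>.
\<close>

definition galois_class :: "int poly \<Rightarrow> (nat \<Rightarrow> nat) set set" where
  "galois_class P = {galois_perms P \<phi> |\<phi>. bij_betw \<phi> {1..degree P} (marked_roots P)}"

end

theory Submission
  imports Defs "HOL-Real_Asymp.Real_Asymp"
begin

text \<open>
  Replacing \<open>a\<close> by \<open>k a\<close> with \<open>k \<noteq> 0\<close> multiplies the roots of the characteristic polynomial by
  \<open>k\<close> and so does not change the Galois group. Hence it suffices to find \<open>b \<in> E\<close> such that for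
  each of finitely many matrices \<open>a\<close>, one for each Galois group, some \<open>b + k a\<close> with \<open>k \<ge> 1\<close>
  lies in \<open>E\<close>. For a single \<open>a\<close>, let \<open>D\<close> be the set of those \<open>b \<in> E\<close> without such a \<open>k\<close>. The
  translates of \<open>D\<close> by the multiples of \<open>a\<close> are pairwise disjoint, so \<open>D\<close> has density zero
  along every sequence of boxes. Finitely many such sets cannot cover \<open>E\<close>.
\<close>

section \<open>Scaling the roots of a polynomial\<close>

text \<open>Split off the full power of \<open>[:- (c * z), 1:]\<close> from \<open>p\<close>.
  Substituting \<open>c * t\<close> turns this factor into a nonzero multiple of
  \<open>[:- z, 1:]\<close>, and the cofactor stays nonzero at \<open>z\<close>.\<close>

lemma order_pcompose_scale:
  fixes p :: "'a :: field poly"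
  assumes p: "p \<noteq> 0" and c: "c \<noteq> 0"
  shows "Polynomial.order z (p \<circ>\<^sub>p [:0, c:]) = Polynomial.order (c * z) p"
proof -
  define n where "n = Polynomial.order (c * z) p"
  obtain q where pq: "p = [:- (c * z), 1:] ^ n * q" and q: "\<not> [:- (c * z), 1:] dvd q"
    using order_decomp[OF p, of "c * z"] unfolding n_def by blast
  have lin: "[:- (c * z), 1:] \<circ>\<^sub>p [:0, c:] = Polynomial.smult c [:- z, 1:]"
    by (simp add: pcompose_pCons)
  have "p \<circ>\<^sub>p [:0, c:] = Polynomial.smult (c ^ n) ([:- z, 1:] ^ n * (q \<circ>\<^sub>p [:0, c:]))"
    unfolding pq pcompose_mult pcompose_hom.hom_power lin by (simp only: smult_power mult_smult_left)
  moreover have "poly (q \<circ>\<^sub>p [:0, c:]) z \<noteq> 0"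
    using q by (simp add: poly_pcompose mult.commute poly_eq_0_iff_dvd)
  then have "Polynomial.order z (q \<circ>\<^sub>p [:0, c:]) = 0" "q \<circ>\<^sub>p [:0, c:] \<noteq> 0"
    by (auto simp: order_root)
  ultimately show ?thesis
    using c by (simp add: order_smult order_mult order_power_n_n n_def)
qed

lemma generate_field_least:
  assumes "H \<subseteq> generate_field R H'"
  shows "generate_field R H \<subseteq> generate_field R H'"
proof
  fix x assume "x \<in> generate_field R H"
  then show "x \<in> generate_field R H'"
    using assms by induction (auto intro: generate_field.intros)
qed

lemma of_int_in_generate_field:
  "of_int k \<in> generate_field (class_ring :: complex ring) H"
proof -
  have one: "1 \<in> generate_field (class_ring :: complex ring) H"
    using generate_field.one[of class_ring H] by simp
  have neg: "- x \<in> generate_field class_ring H"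
    if "x \<in> generate_field class_ring H" for x :: complex
    using generate_field.a_inv[OF that] by (simp add: class_ring_simps)
  have add: "x + y \<in> generate_field class_ring H"
    if "x \<in> generate_field class_ring H" "y \<in> generate_field class_ring H" for x y :: complex
    using generate_field.eng_add[OF that] by simp
  have zero: "0 \<in> generate_field (class_ring :: complex ring) H"
    using add[OF one neg[OF one]] by simp
  show ?thesis
  proof (induction k rule: int_induct[of _ 0])
    case base
    show ?case using zero by simp
  next
    case (step1 i)
    then show ?case using add[OF _ one] by simp
  next
    case (step2 i)
    then show ?case using add[OF _ neg[OF one], of "of_int i"] by simp
  qed
qed

text \<open>A generated field contains every integer, hence also the inverse of \<open>k\<close>, so
  each of the two generating sets lies in the field generated by the other.\<close>

lemma generate_field_scale:
  fixes k :: int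
  assumes k: "k \<noteq> 0"
  shows "generate_field class_ring ((\<lambda>z. of_int k * z) ` S) =
         generate_field (class_ring :: complex ring) S"
proof (intro equalityI generate_field_least subsetI)
  fix x :: complex
  assume "x \<in> (\<lambda>z. of_int k * z) ` S"
  then obtain z where z: "z \<in> S" "x = of_int k * z" by auto
  show "x \<in> generate_field class_ring S"
    using generate_field.eng_mult[OF of_int_in_generate_field[of k S] generate_field.incl[OF z(1)]]
    by (simp add: z(2))
next
  fix x :: complex
  assume x: "x \<in> S"
  let ?K = "generate_field class_ring ((\<lambda>z. of_int k * z) ` S)"
  have "inverse (of_int k) \<in> ?K"
    using generate_field.m_inv[OF of_int_in_generate_field[of k]] k
    by (simp add: class_ring_simps)
  moreover have "of_int k * x \<in> ?K"
    using x by (blast intro: generate_field.incl)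
  ultimately have "inverse (of_int k) * (of_int k * x) \<in> ?K"
    using generate_field.eng_mult[of "inverse (of_int k)" class_ring _ "of_int k * x"] by simp
  moreover have "inverse (of_int k) * (of_int k * x) = x" using k by simp
  ultimately show "x \<in> ?K" by simp
qed

text \<open>Multiplication by \<open>k\<close> carries the roots of \<open>Q\<close> to those of
  \<open>P\<close> with multiplicities and commutes with Galois automorphisms, so corresponding
  listings give the same permutations. The factor \<open>c\<close> absorbs the power of
  \<open>k\<close> that appears for characteristic polynomials.\<close>

lemma galois_class_scale:
  fixes P Q :: "int poly" and k c :: int
  assumes k: "k \<noteq> 0" and c: "c \<noteq> 0" and P: "P \<noteq> 0"
    and PQ: "P \<circ>\<^sub>p [:0, k:] = Polynomial.smult c Q"
  shows "galois_class P = galois_class Q"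
proof -
  \<comment> \<open>The maps \<open>s\<close> and \<open>t\<close> scale the root and keep the index
    that separates its copies; they translate listings for \<open>Q\<close> into listings for
    \<open>P\<close> and back.\<close>
  let ?k = "of_int k :: complex"
  define s where "s = (\<lambda>x :: complex \<times> nat. (?k * fst x, snd x))"
  define t where "t = (\<lambda>x :: complex \<times> nat. (fst x / ?k, snd x))"
  have st: "s (t x) = x" "t (s x) = x" for x
    using k by (auto simp: s_def t_def)
  have comp: "complex_poly P \<circ>\<^sub>p [:0, ?k:] = Polynomial.smult (of_int c) (complex_poly Q)"
    using arg_cong[OF PQ, of complex_poly]
    by (simp add: of_int_hom.map_poly_pcompose of_int_hom.map_poly_hom_smult
        of_int_hom.map_poly_pCons_hom)
  have deg: "degree P = degree Q"
    using arg_cong[OF PQ, of degree] k c by (simp add: degree_pcompose)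
  have poly: "poly (complex_poly P) (?k * z) = 0 \<longleftrightarrow> poly (complex_poly Q) z = 0" for z
    using arg_cong[OF comp, of "\<lambda>p. poly p z"] c by (simp add: poly_pcompose mult.commute)
  have order: "Polynomial.order (?k * z) (complex_poly P) = Polynomial.order z (complex_poly Q)" for z
    using order_pcompose_scale[of "complex_poly P" ?k z] P k c
    unfolding comp by (simp add: order_smult)
  have "{z. poly (complex_poly P) z = 0} = (\<lambda>z. ?k * z) ` {z. poly (complex_poly Q) z = 0}"
  proof (intro equalityI subsetI)
    fix z assume "z \<in> {z. poly (complex_poly P) z = 0}"
    then have "z / ?k \<in> {z. poly (complex_poly Q) z = 0}" using poly[of "z / ?k"] k by simp
    moreover have "z = ?k * (z / ?k)" using k by simp
    ultimately show "z \<in> (\<lambda>z. ?k * z) ` {z. poly (complex_poly Q) z = 0}" by (rule rev_image_eqI)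
  qed (auto simp: poly)
  then have sf: "splitting_field P = splitting_field Q"
    using k by (simp add: splitting_field_def generate_field_scale)
  then have gal: "galois_automorphisms P = galois_automorphisms Q"
    by (simp add: galois_automorphisms_def)
  have marked: "s x \<in> marked_roots P \<longleftrightarrow> x \<in> marked_roots Q" for x
    by (auto simp: s_def marked_roots_def poly order split: prod.splits)
  have bij: "bij_betw s (marked_roots Q) (marked_roots P)"
    by (rule bij_betw_byWitness[of _ t]) (use marked st in auto, metis marked st(1))
  have bij': "bij_betw t (marked_roots P) (marked_roots Q)"
    by (rule bij_betw_byWitness[of _ s]) (use marked st in auto, metis marked st(1))
  \<comment> \<open>An automorphism fixes the rational number \<open>k\<close> and is multiplicative
    on the splitting field. It is controlled only there, hence the restriction to roots
    \<open>z\<close>.\<close>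
  have linear: "\<sigma> (?k * z) = ?k * \<sigma> z"
    if \<sigma>: "\<sigma> \<in> galois_automorphisms Q" and z: "poly (complex_poly Q) z = 0" for \<sigma> z
  proof -
    have hom: "\<sigma> \<in> ring_hom (splitting_field Q) (splitting_field Q)" and fix_rat: "\<sigma> ?k = ?k"
      using \<sigma> by (auto simp: galois_automorphisms_def ring_iso_def)
    have "?k \<in> carrier (splitting_field Q)" "z \<in> carrier (splitting_field Q)"
      using z by (auto simp: splitting_field_def of_int_in_generate_field intro: generate_field.incl)
    from ring_hom_mult[OF hom this] show ?thesis
      using fix_rat by (simp add: splitting_field_def)
  qed
  have perms: "galois_perms P (s \<circ> \<phi>) = galois_perms Q \<phi>"
    if \<phi>: "bij_betw \<phi> {1..degree Q} (marked_roots Q)" for \<phi>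
  proof -
    have "s (\<phi> (p j)) = (\<sigma> (fst (s (\<phi> j))), snd (s (\<phi> j))) \<longleftrightarrow>
          \<phi> (p j) = (\<sigma> (fst (\<phi> j)), snd (\<phi> j))"
      if "\<sigma> \<in> galois_automorphisms Q" "j \<in> {1..degree Q}" for \<sigma> p j
    proof -
      have "\<phi> j \<in> marked_roots Q" using \<phi> that(2) by (auto dest: bij_betwE)
      then have "poly (complex_poly Q) (fst (\<phi> j)) = 0" by (auto simp: marked_roots_def)
      from linear[OF that(1) this] show ?thesis
        using k by (auto simp: s_def prod_eq_iff)
    qed
    then show ?thesis
      unfolding galois_perms_def gal deg comp_def by (intro Collect_cong) (auto 4 3)
  qed
  show ?thesis
  proof (intro equalityI subsetI)
    fix G assume "G \<in> galois_class P"
    then obtain \<phi> where \<phi>: "bij_betw \<phi> {1..degree P} (marked_roots P)" "G = galois_perms P \<phi>"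
      by (auto simp: galois_class_def)
    have "bij_betw (t \<circ> \<phi>) {1..degree Q} (marked_roots Q)"
      using bij_betw_trans[OF \<phi>(1) bij'] deg by simp
    moreover from perms[OF this] have "G = galois_perms Q (t \<circ> \<phi>)"
      by (simp add: \<phi>(2) comp_def st)
    ultimately show "G \<in> galois_class Q" by (auto simp: galois_class_def)
  next
    fix G assume "G \<in> galois_class Q"
    then obtain \<phi> where \<phi>: "bij_betw \<phi> {1..degree Q} (marked_roots Q)" "G = galois_perms Q \<phi>"
      by (auto simp: galois_class_def)
    have "bij_betw (s \<circ> \<phi>) {1..degree P} (marked_roots P)"
      using bij_betw_trans[OF \<phi>(1) bij] deg by simp
    then show "G \<in> galois_class P"
      using perms[OF \<phi>(1)] \<phi>(2) by (auto simp: galois_class_def)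
  qed
qed

text \<open>Entrywise, kt I - ka = k (t I - a). Substitution is a ring homomorphism, so it commutes
  with the determinant, and the scalar comes out to the power \<open>n\<close>.\<close>

lemma char_poly_smult_pcompose:
  fixes a :: "'a :: idom mat"
  assumes a: "a \<in> carrier_mat n n"
  shows "char_poly (k \<cdot>\<^sub>m a) \<circ>\<^sub>p [:0, k:] = Polynomial.smult (k ^ n) (char_poly a)"
proof -
  have "map_mat (\<lambda>q. q \<circ>\<^sub>p [:0, k:]) (char_poly_matrix (k \<cdot>\<^sub>m a)) = [:k:] \<cdot>\<^sub>m char_poly_matrix a"
    using a by (intro eq_matI) (auto simp: char_poly_matrix_def pcompose_pCons pcompose_add)
  then have "char_poly (k \<cdot>\<^sub>m a) \<circ>\<^sub>p [:0, k:] = [:k:] ^ n * char_poly a"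
    using a unfolding char_poly_def comm_ring_hom.hom_det[OF pcompose_hom.comm_ring_hom_axioms, symmetric]
    by (simp add: char_poly_matrix_def)
  then show ?thesis by (simp add: poly_const_pow)
qed

lemma galois_class_char_poly_smult:
  fixes k :: int
  assumes a: "a \<in> carrier_mat n n" and k: "k \<noteq> 0"
  shows "galois_class (char_poly (k \<cdot>\<^sub>m a)) = galois_class (char_poly a)"
proof -
  have "monic (char_poly (k \<cdot>\<^sub>m a))" using degree_monic_char_poly[of "k \<cdot>\<^sub>m a" n] a by auto
  then have "char_poly (k \<cdot>\<^sub>m a) \<noteq> 0" by auto
  then show ?thesis
    using galois_class_scale[OF k _ _ char_poly_smult_pcompose[OF a]] k by simp
qed

text \<open>This is what reduces the theorem to finitely many matrices: a class is a set of subsets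
  of the finite group of permutations of \<open>{1..d}\<close>.\<close>

lemma finite_galois_classes: "finite {galois_class P |P. degree P = d}"
proof (rule finite_subset)
  show "{galois_class P |P. degree P = d} \<subseteq> Pow (Pow {p. p permutes {1..d}})"
    by (auto simp: galois_class_def galois_perms_def)
qed (simp add: finite_permutations)

section \<open>Recurrence in sets of positive density\<close>

lemma card_box: "finite (box N n)" "card (box N n) = (2 * n + 1) ^ N"
proof -
  \<comment> \<open>Extensional functions are determined by their values on the indices, which makes
    \<open>vec N\<close> injective on them.\<close>
  let ?F = "PiE {..<N} (\<lambda>_. {- int n..int n})"
  have "inj_on (vec N) ?F"
  proof (rule inj_onI)
    fix f g assume fg: "f \<in> ?F" "g \<in> ?F" and eq: "vec N f = vec N g"
    show "f = g"
    proof (rule PiE_ext[OF fg])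
      fix i assume "i \<in> {..<N}"
      then show "f i = g i" using arg_cong[OF eq, of "\<lambda>v. v $ i"] by simp
    qed
  qed
  moreover have "vec N ` ?F = box N n"
  proof (intro equalityI subsetI)
    fix v assume v: "v \<in> box N n"
    have "v = vec N (restrict (($) v) {..<N})"
      using v by (intro eq_vecI) (auto simp: box_def)
    moreover have "restrict (($) v) {..<N} \<in> ?F"
      using v by (force simp: box_def abs_le_iff)
    ultimately show "v \<in> vec N ` ?F" by blast
  qed (force simp: box_def abs_le_iff Pi_iff PiE_def)
  ultimately have "bij_betw (vec N) ?F (box N n)" by (simp add: bij_betw_def)
  moreover have "finite ?F" by (simp add: finite_PiE)
  moreover have "card ?F = (2 * n + 1) ^ N" by (simp add: card_PiE nat_add_distrib nat_mult_distrib)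
  ultimately show "finite (box N n)" "card (box N n) = (2 * n + 1) ^ N"
    by (auto simp: bij_betw_finite bij_betw_same_card)
qed

text \<open>The translates of \<open>A\<close> by \<open>0, v, \<dots>, (M - 1) v\<close> are pairwise disjoint.\<close>

lemma card_nonreturning_box:
  fixes A :: "int vec set" and v a :: "int vec"
  assumes v: "v \<in> carrier_vec N" and a: "a \<in> carrier_vec N"
    and bound: "\<And>i. i < N \<Longrightarrow> \<bar>v $ i\<bar> \<le> int c"
    and A: "\<And>w k. w \<in> A \<Longrightarrow> k \<ge> 1 \<Longrightarrow> w + int k \<cdot>\<^sub>v v \<notin> A"
  shows "M * card (A \<inter> (\<lambda>w. w + a) ` box N n) \<le> card (box N (n + M * c))"
proof -
  let ?S = "A \<inter> (\<lambda>w. w + a) ` box N n"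
  \<comment> \<open>Subtracting \<open>a\<close> recentres the translates, so that all of them fit
    into one box around the origin.\<close>
  let ?f = "\<lambda>(j, w). w + int j \<cdot>\<^sub>v v - a"
  have carr: "w \<in> carrier_vec N" if "w \<in> ?S" for w
    using that a by (auto simp: box_def)
  \<comment> \<open>A coincidence with \<open>i \<le> j\<close> exhibits \<open>w\<close> as a
    return of \<open>w'\<close> after \<open>j - i\<close> steps, which the hypothesis on
    \<open>A\<close> excludes unless \<open>i = j\<close>.\<close>
  have shift: "i = j \<and> w = w'"
    if w: "w \<in> ?S" "w' \<in> ?S" and le: "i \<le> j" and eq: "?f (i, w) = ?f (j, w')" for i j w w'
  proof -
    have "w = w' + int (j - i) \<cdot>\<^sub>v v"
    proof (rule eq_vecI)
      fix m assume "m < dim_vec (w' + int (j - i) \<cdot>\<^sub>v v)"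
      then show "w $ m = (w' + int (j - i) \<cdot>\<^sub>v v) $ m"
        using arg_cong[OF eq, of "\<lambda>u. u $ m"] carr[OF w(1)] carr[OF w(2)] v a le
        by (auto simp: of_nat_diff algebra_simps)
    qed (use carr[OF w(1)] v in auto)
    moreover from this have "\<not> j - i \<ge> 1" using A[of w' "j - i"] w by auto
    ultimately show ?thesis using le carr[OF w(2)] v by auto
  qed
  have "inj_on ?f ({..<M} \<times> ?S)"
  proof (rule inj_onI)
    fix x y
    assume "x \<in> {..<M} \<times> ?S" "y \<in> {..<M} \<times> ?S" and eq: "?f x = ?f y"
    then have S: "snd x \<in> ?S" "snd y \<in> ?S" by (simp_all only: mem_Times_iff)
    consider "fst x \<le> fst y" | "fst y \<le> fst x" by linarith
    then show "x = y"
    proof cases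
      case 1
      show ?thesis using shift[OF S 1] eq by (simp add: prod_eq_iff)
    next
      case 2
      show ?thesis using shift[OF S(2,1) 2] eq by (simp add: prod_eq_iff)
    qed
  qed
  moreover have "?f ` ({..<M} \<times> ?S) \<subseteq> box N (n + M * c)"
  proof (clarsimp)
    fix j u assume j: "j < M" and u: "u \<in> box N n"
    show "u + a + int j \<cdot>\<^sub>v v - a \<in> box N (n + M * c)"
      unfolding box_def
    proof (intro CollectI conjI allI impI)
      fix i assume i: "i < N"
      have "(u + a + int j \<cdot>\<^sub>v v - a) $ i = u $ i + int j * v $ i"
        using i u v a by (auto simp: box_def)
      also have "\<bar>\<dots>\<bar> \<le> \<bar>u $ i\<bar> + int j * \<bar>v $ i\<bar>"
        by (metis abs_triangle_ineq abs_mult abs_of_nat)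
      also have "\<dots> \<le> int n + int M * int c"
        using i u j bound[OF i] by (intro add_mono mult_mono) (auto simp: box_def)
      finally show "\<bar>(u + a + int j \<cdot>\<^sub>v v - a) $ i\<bar> \<le> int (n + M * c)" by simp
    qed (use u v a in \<open>auto simp: box_def\<close>)
  qed
  ultimately have "card ({..<M} \<times> ?S) \<le> card (box N (n + M * c))"
    using card_box(1) by (rule card_inj_on_le)
  then show ?thesis by (simp add: card_cartesian_product)
qed

text \<open>Packing \<open>M\<close> disjoint translates into a box enlarged by a constant bounds
  the density by about 1/M once \<open>n\<close> is large, and \<open>M\<close> is
  arbitrary.\<close>

lemma nonreturning_density_zero:
  fixes A :: "int vec set" and v :: "int vec" and a :: "nat \<Rightarrow> int vec"
  assumes v: "v \<in> carrier_vec N" and a: "\<And>n. a n \<in> carrier_vec N"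
    and A: "\<And>w k. w \<in> A \<Longrightarrow> k \<ge> 1 \<Longrightarrow> w + int k \<cdot>\<^sub>v v \<notin> A"
  shows "(\<lambda>n. real (card (A \<inter> (\<lambda>w. w + a n) ` box N n)) / real (card (box N n)))
           \<longlonglongrightarrow> 0" (is "?r \<longlonglongrightarrow> 0")
proof (rule order_tendstoI)
  fix e :: real assume e: "0 < e"
  obtain M :: nat where M: "inverse e < real M" using reals_Archimedean2 by blast
  then have M0: "real M > 0" using e by (meson less_trans positive_imp_inverse_positive)
  \<comment> \<open>A sum bounds every entry just as a maximum would, and it also makes sense for
    \<open>N = 0\<close>.\<close>
  define c where "c = (\<Sum>i<N. nat \<bar>v $ i\<bar>)"
  have bound: "\<bar>v $ i\<bar> \<le> int c" if "i < N" for i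
    using member_le_sum[of i "{..<N}" "\<lambda>i. \<bar>v $ i\<bar>"] that by (simp add: c_def)
  \<comment> \<open>The power \<open>u n ^ N\<close> is the ratio of the sizes of the enlarged and
    the original box; it tends to 1 because \<open>M * c\<close> is fixed.\<close>
  define u where "u = (\<lambda>n :: nat. (2 * (real n + real (M * c)) + 1) / (2 * real n + 1))"
  have "u \<longlonglongrightarrow> 1" unfolding u_def by real_asymp
  then have "(\<lambda>n. u n ^ N / real M) \<longlonglongrightarrow> 1 ^ N / real M"
    using M0 by (intro tendsto_intros) auto
  moreover have "1 ^ N / real M < e"
    using M M0 e by (simp add: field_simps)
  ultimately have "\<forall>\<^sub>F n in sequentially. u n ^ N / real M < e" by (rule order_tendstoD)
  then show "\<forall>\<^sub>F n in sequentially. ?r n < e"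
  proof eventually_elim
    case (elim n)
    have "real M * real (card (A \<inter> (\<lambda>w. w + a n) ` box N n)) \<le> real (card (box N (n + M * c)))"
      using card_nonreturning_box[OF v a bound A, of M n n]
      unfolding of_nat_mult[symmetric] of_nat_le_iff .
    then have "?r n \<le> (real (card (box N (n + M * c))) / real M) / real (card (box N n))"
      using M0 by (intro divide_right_mono) (auto simp: field_simps)
    also have "\<dots> = u n ^ N / real M"
      by (simp add: card_box u_def power_divide field_simps)
    finally show ?case using elim by simp
  qed
next
  fix e :: real assume "e < 0"
  then show "\<forall>\<^sub>F n in sequentially. e < ?r n"
    by (intro always_eventually allI) (auto intro: less_le_trans)
qed

text \<open>If no such \<open>w\<close> existed, every point of \<open>E\<close> would fail to
  return along some \<open>v\<close> in \<open>V\<close>, so \<open>E\<close> would be a finite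
  union of sets of density zero.\<close>

lemma simultaneous_return:
  fixes E :: "int vec set" and V :: "int vec set"
  assumes V: "finite V" "V \<subseteq> carrier_vec N"
    and E: "upper_banach_density N E > 0"
  shows "\<exists>w\<in>E. \<forall>v\<in>V. \<exists>k\<ge>1. w + int k \<cdot>\<^sub>v v \<in> E"
proof (rule ccontr)
  assume none: "\<not> ?thesis"
  define D where "D = (\<lambda>v. {w \<in> E. \<forall>k\<ge>1. w + int k \<cdot>\<^sub>v v \<notin> E})"
  have cover: "E \<subseteq> (\<Union>v\<in>V. D v)" using none by (auto simp: D_def)
  let ?r = "\<lambda>A a n. real (card (A \<inter> (\<lambda>w. w + a n) ` box N n)) / real (card (box N n))"
  have "limsup (\<lambda>n. ereal (?r E a n)) = 0"
    if a: "\<forall>n. a n \<in> carrier_vec N" for a :: "nat \<Rightarrow> int vec"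
  proof -
    have "(\<lambda>n. ?r (D v) a n) \<longlonglongrightarrow> 0" if "v \<in> V" for v
      \<comment> \<open>A point of \<open>D v\<close> never returns to \<open>E\<close>, hence never
        to its subset \<open>D v\<close>.\<close>
      using that V(2) a by (intro nonreturning_density_zero[of v]) (auto simp: D_def)
    then have lim: "(\<lambda>n. \<Sum>v\<in>V. ?r (D v) a n) \<longlonglongrightarrow> 0"
      by (intro tendsto_null_sum) auto
    have le: "?r E a n \<le> (\<Sum>v\<in>V. ?r (D v) a n)" for n
    proof -
      let ?F = "(\<lambda>w. w + a n) ` box N n"
      have "card (E \<inter> ?F) \<le> card (\<Union>v\<in>V. D v \<inter> ?F)"
        using cover V(1) card_box(1) by (intro card_mono) auto
      also have "\<dots> \<le> (\<Sum>v\<in>V. card (D v \<inter> ?F))"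
        using V(1) by (rule card_UN_le)
      finally have "real (card (E \<inter> ?F)) \<le> (\<Sum>v\<in>V. real (card (D v \<inter> ?F)))"
        unfolding of_nat_sum[symmetric] of_nat_le_iff .
      then show ?thesis
        unfolding sum_divide_distrib[symmetric] by (rule divide_right_mono) simp
    qed
    have "?r E a \<longlonglongrightarrow> 0"
      by (rule tendsto_sandwich[OF _ _ tendsto_const lim]) (use le in auto)
    then have "(\<lambda>n. ereal (?r E a n)) \<longlonglongrightarrow> ereal 0" by simp
    from lim_imp_Limsup[OF sequentially_bot this] show ?thesis by (simp add: zero_ereal_def)
  qed
  then have "upper_banach_density N E \<le> 0"
    unfolding upper_banach_density_def by (intro SUP_least) auto
  with E show False by simp
qed

section \<open>From returns in coordinates to Galois groups of differences\<close>

lemma mat_combination_add_smult: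
  assumes "w \<in> carrier_vec N" "v \<in> carrier_vec N"
  shows "mat_combination d N B (w + k \<cdot>\<^sub>v v) - mat_combination d N B w =
         k \<cdot>\<^sub>m mat_combination d N B v"
  using assms
  by (intro eq_matI)
    (auto simp: mat_combination_def algebra_simps sum.distrib sum_distrib_left)

theorem corollary1p6:
  fixes d :: nat and B :: "nat \<Rightarrow> int mat" and E :: "int mat set"
  assumes "d \<ge> 2"
    and "trace_zero_basis d B"
    and "E \<subseteq> trace_zero_mats d"
    and "upper_banach_density (d\<^sup>2 - 1) (coordinates d B E) > 0"
  shows "\<exists>b\<in>E. {galois_class (char_poly a) |a. a \<in> trace_zero_mats d}
                 \<subseteq> {galois_class (char_poly (e - b)) |e. e \<in> E}"
proof -
  let ?N = "d\<^sup>2 - 1"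
  let ?mat = "mat_combination d ?N B"
  define \<G> where "\<G> = {galois_class (char_poly a) |a. a \<in> trace_zero_mats d}"
  have "\<G> \<subseteq> {galois_class P |P. degree P = d}"
    using degree_monic_char_poly[of _ d] unfolding \<G>_def trace_zero_mats_def by blast
  then have fin: "finite \<G>" using finite_galois_classes by (rule finite_subset)
  have "\<exists>v. v \<in> carrier_vec ?N \<and> galois_class (char_poly (?mat v)) = G" if G: "G \<in> \<G>" for G
  proof -
    obtain a where a: "a \<in> trace_zero_mats d" "G = galois_class (char_poly a)" using G unfolding \<G>_def by blast
    then obtain v where "v \<in> carrier_vec ?N" "a = ?mat v"
      using assms(2) unfolding trace_zero_basis_def by metis
    then show ?thesis using a(2) by blast
  qed
  \<comment> \<open>One coordinate vector is chosen for each Galois class.\<close>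
  then obtain v where v: "\<And>G. G \<in> \<G> \<Longrightarrow> v G \<in> carrier_vec ?N"
    "\<And>G. G \<in> \<G> \<Longrightarrow> galois_class (char_poly (?mat (v G))) = G"
    by metis
  \<comment> \<open>The single point \<open>w\<close> serves all classes at once; its matrix is the
    required \<open>b\<close>, while the return time \<open>k\<close> may depend on the
    class.\<close>
  obtain w where w: "w \<in> coordinates d B E"
    "\<forall>u\<in>v ` \<G>. \<exists>k\<ge>1. w + int k \<cdot>\<^sub>v u \<in> coordinates d B E"
    using simultaneous_return[OF _ _ assms(4), of "v ` \<G>"] fin v(1) by blast
  have wN: "w \<in> carrier_vec ?N" "?mat w \<in> E" using w(1) by (auto simp: coordinates_def)
  show ?thesis
    unfolding \<G>_def[symmetric]
  proof (intro bexI[OF _ wN(2)] subsetI)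
    fix G assume G: "G \<in> \<G>"
    then obtain k :: nat where k: "k \<ge> 1" "w + int k \<cdot>\<^sub>v v G \<in> coordinates d B E"
      using w(2) by blast
    have "galois_class (char_poly (?mat (w + int k \<cdot>\<^sub>v v G) - ?mat w)) =
          galois_class (char_poly (int k \<cdot>\<^sub>m ?mat (v G)))"
      by (simp only: mat_combination_add_smult[OF wN(1) v(1)[OF G]])
    \<comment> \<open>The return time is at least 1, so the scalar is nonzero and the Galois class
      is unchanged.\<close>
    also have "\<dots> = G"
      using k(1) v(2)[OF G]
      by (subst galois_class_char_poly_smult[where n = d]) (auto simp: mat_combination_def)
    finally have "G = galois_class (char_poly (?mat (w + int k \<cdot>\<^sub>v v G) - ?mat w))" by simp
    moreover have "?mat (w + int k \<cdot>\<^sub>v v G) \<in> E" using k(2) by (simp add: coordinates_def)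
    ultimately show "G \<in> {galois_class (char_poly (e - ?mat w)) |e. e \<in> E}" by blast
  qed
qed

end
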